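(* Let $h$ be a Hilbert function for an ideal of the polynomial ring in $n$ variables. Let $Q(n,D,h)$ be the polytope (defined in the context) whose vertices are in one-to-one correspondence with the distinct monomial ideals in $n$ variables, with generators of degree less than or equal to $D$, and Hilbert function $h$. Then the probability of generating a random monomial ideal $\mathfrak I\sim\mathcal I(n,D,p)$ with Hilbert function $h$ is $$P(h_{\mathfrak I}=h)=(1-p)^{\sum_{d=1}^{D}h(d)}\sum_{v\in V(Q(n,D,h))}p^{\beta_1(v)},$$ where $V(Q(n,D,h))$ is the set of vertices of $Q(n,D,h)$ and $\beta_1(v)$ is the first total Betti number (the number of minimal generators) of the monomial ideal associated to the vertex $v$.
   Context: Let $k$ be a field and $S=k[x_1,\dots,x_n]$. Given an integer $D$ and $p\in[0,1]$, let $\mathfrak B$ be the random set of monomials of $S$ obtained by including each non-constant monomial of total degree at most $D$ independently with probability $p$. $\mathcal I(n,D,p)$ is the distribution of the random monomial ideal $\mathfrak I=(\mathfrak B)$, with $\mathfrak I=(0)$ if $\mathfrak B=\emptyset$. For a monomial ideal $I$, the Hilbert function value $h_I(d)$ is the number of monomials of degree exactly $d$ not in $I$. $Q(n,D,h)$ is the $0$-$1$ convex polytope in the $\binom{n+D}{D}-1$ variables $x_\alpha$, indexed by $\alpha\in\mathbb Z_{\ge0}^n$ with $0<|\alpha|\le D$ (where $|\alpha|=\sum_i\alpha_i$), defined by $\sum_{|\alpha|=L}x_\alpha=\binom{n+L-1}{L}-h(L)$ for all $L=1,\dots,D$, and $x_\alpha\le x_\gamma$ for all $\alpha\le\gamma$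 (componentwise) with $|\alpha|+1=|\gamma|$. The variable $x_\alpha$ records whether the monomial $x^\alpha$ is in the ideal ($x_\alpha=1$) or not ($x_\alpha=0$), and this associates a monomial ideal to a vertex.
   Formalization: Equality with h is in degrees 1..D only (vertex correspondence proved); equality in all degrees is shown only if the stated one-to-one correspondence holds, as it can fail (n=D=2, h=1,2,1,1,...). Q is the convex hull of the 0-1 solutions, as the linear system can have fractional vertices. *)

theory Defs
  imports
    "HOL-Probability.Probability"
    "HOL-Analysis.Finite_Function_Topology"
begin

text \<open>
  The finite index type \<open>'n\<close> stands for the set of the \<open>n = CARD('n)\<close> variables.  Exponent vectors
  are \<open>'n \<Rightarrow>\<^sub>0 nat\<close> and the polynomial ring \<open>S = k[x_1, ..., x_n]\<close> is the monoid algebra provided by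
  \<^theory>\<open>HOL-Library.Poly_Mapping\<close>.  Beware that the library order on \<open>'n \<Rightarrow>\<^sub>0 nat\<close> is not the
  componentwise one.
\<close>

type_synonym 'n expo = "'n \<Rightarrow>\<^sub>0 nat"
type_synonym ('n, 'k) mpoly = "('n \<Rightarrow>\<^sub>0 nat) \<Rightarrow>\<^sub>0 'k"

definition tdeg :: "'n::finite expo \<Rightarrow> nat" where
  "tdeg \<alpha> = (\<Sum>i\<in>UNIV. Poly_Mapping.lookup \<alpha> i)"

definition cle :: "'n expo \<Rightarrow> 'n expo \<Rightarrow> bool" (infix \<open>\<sqsubseteq>\<^sub>c\<close> 50) where
  "\<alpha> \<sqsubseteq>\<^sub>c \<gamma> \<longleftrightarrow> (\<forall>i. Poly_Mapping.lookup \<alpha> i \<le> Poly_Mapping.lookup \<gamma> i)"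

definition exps :: "nat \<Rightarrow> 'n::finite expo set" where
  "exps D = {\<alpha>. 0 < tdeg \<alpha> \<and> tdeg \<alpha> \<le> D}"

definition mon :: "'n expo \<Rightarrow> ('n, 'k::field) mpoly" where
  "mon \<alpha> = Poly_Mapping.single \<alpha> 1"


section \<open>Ideals and Hilbert functions\<close>

text \<open>Ideals are the submodules of the ring regarded as a module over itself.\<close>

definition ideal_gen :: "('n, 'k::field) mpoly set \<Rightarrow> ('n, 'k) mpoly set" where
  "ideal_gen B = module.span (*) B"

definition graded_piece :: "nat \<Rightarrow> ('n::finite, 'k::field) mpoly set" where
  "graded_piece d = {f. \<forall>\<alpha>\<in>Poly_Mapping.keys f. tdeg \<alpha> = d}"

definition homogeneous_ideal :: "('n::finite, 'k::field) mpoly set \<Rightarrow> bool" where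
  "homogeneous_ideal I \<longleftrightarrow> (\<exists>B \<subseteq> (\<Union>d. graded_piece d). I = ideal_gen B)"

definition kscale :: "'k::field \<Rightarrow> ('n, 'k) mpoly \<Rightarrow> ('n, 'k) mpoly" where
  "kscale c f = Poly_Mapping.single 0 c * f"

text \<open>
  For a homogeneous ideal \<open>I\<close> this is \<open>dim\<^sub>k (S_d / I_d)\<close>, since \<open>S_d\<close> is finite-dimensional and
  \<open>I_d = I \<inter> S_d\<close>.
\<close>

definition hilbert_function :: "('n::finite, 'k::field) mpoly set \<Rightarrow> nat \<Rightarrow> nat" where
  "hilbert_function I d =
     vector_space.dim kscale (graded_piece d :: ('n, 'k) mpoly set)
     - vector_space.dim kscale (I \<inter> graded_piece d)"

text \<open>
  For a monomial ideal the value of the Hilbert function is the number of standard monomials;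
  see \<open>hilbert_function_monomial\<close> below for the agreement of the two notions.
\<close>

definition mon_hilbert :: "('n::finite, 'k::field) mpoly set \<Rightarrow> nat \<Rightarrow> nat" where
  "mon_hilbert I d = card {\<alpha>. tdeg \<alpha> = d \<and> (mon \<alpha> :: ('n, 'k) mpoly) \<notin> I}"

definition monomial_ideals_upto :: "nat \<Rightarrow> ('n::finite, 'k::field) mpoly set set" where
  "monomial_ideals_upto D = {I. \<exists>A \<subseteq> exps D. I = ideal_gen (mon ` A)}"

text \<open>
  The exponents of the minimal monomial generators: the unique irredundant set of
  monomials that generates the monomial ideal \<open>I\<close>; see \<open>min_gens_eq\<close> below.
\<close>

definition min_gens :: "('n::finite, 'k::field) mpoly set \<Rightarrow> 'n expo set" where
  "min_gens I = (THE G. ideal_gen (mon ` G) = I \<and> (\<forall>G'. G' \<subset> G \<longrightarrow> ideal_gen (mon ` G') \<noteq> I))"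

definition betti1 :: "('n::finite, 'k::field) mpoly set \<Rightarrow> nat" where
  "betti1 I = card (min_gens I)"


section \<open>Random monomial ideals\<close>

definition random_monomials :: "nat \<Rightarrow> real \<Rightarrow> 'n::finite expo set pmf" where
  "random_monomials D p =
     map_pmf (\<lambda>b. {\<alpha>. b \<alpha>}) (Pi_pmf (exps D) False (\<lambda>_. bernoulli_pmf p))"

definition random_monomial_ideal :: "nat \<Rightarrow> real \<Rightarrow> ('n::finite, 'k::field) mpoly set pmf" where
  "random_monomial_ideal D p = map_pmf (\<lambda>B. ideal_gen (mon ` B)) (random_monomials D p)"


section \<open>The polytope \<open>Q(n, D, h)\<close>\<close>

text \<open>
  Points are elements of \<open>'n expo \<Rightarrow>\<^sub>0 real\<close> supported on the coordinates \<open>0 < |\<alpha>| \<le> D\<close>.  The polytope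
  is the convex hull of the 0-1 solutions of the system; the linear relaxation of the
  system may have further, fractional vertices.
\<close>

definition Q_points :: "nat \<Rightarrow> (nat \<Rightarrow> nat) \<Rightarrow> ('n::finite expo \<Rightarrow>\<^sub>0 real) set" where
  "Q_points D h = {x.
     Poly_Mapping.keys x \<subseteq> exps D \<and>
     (\<forall>\<alpha>\<in>exps D. Poly_Mapping.lookup x \<alpha> \<in> {0, 1}) \<and>
     (\<forall>L\<in>{1..D}. (\<Sum>\<alpha> | tdeg \<alpha> = L. Poly_Mapping.lookup x \<alpha>)
                   = real ((CARD('n) + L - 1) choose L) - real (h L)) \<and>
     (\<forall>\<alpha>\<in>exps D. \<forall>\<gamma>\<in>exps D. \<alpha> \<sqsubseteq>\<^sub>c \<gamma> \<and> tdeg \<alpha> + 1 = tdeg \<gamma>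
        \<longrightarrow> Poly_Mapping.lookup x \<alpha> \<le> Poly_Mapping.lookup x \<gamma>)}"

definition Q :: "nat \<Rightarrow> (nat \<Rightarrow> nat) \<Rightarrow> ('n::finite expo \<Rightarrow>\<^sub>0 real) set" where
  "Q D h = convex hull (Q_points D h)"

definition vertices :: "'a::real_vector set \<Rightarrow> 'a set" where
  "vertices P = {v. v extreme_point_of P}"

definition vertex_ideal :: "('n::finite expo \<Rightarrow>\<^sub>0 real) \<Rightarrow> ('n, 'k::field) mpoly set" where
  "vertex_ideal v = ideal_gen (mon ` {\<alpha>. Poly_Mapping.lookup v \<alpha> = 1})"


section \<open>Basic facts\<close>

lemma module_mpoly: "module ((*) :: ('n, 'k::field) mpoly \<Rightarrow> _)"
  by unfold_locales (simp_all add: algebra_simps)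

lemma vector_space_kscale: "vector_space (kscale :: 'k::field \<Rightarrow> ('n, 'k) mpoly \<Rightarrow> _)"
  by unfold_locales
    (simp_all add: kscale_def algebra_simps single_add mult_single flip: mult.assoc)

lemma lookup_kscale: "Poly_Mapping.lookup (kscale c f) \<alpha> = c * Poly_Mapping.lookup f \<alpha>"
proof -
  have "kscale c f = Poly_Mapping.map ((*) c) f"
    by (simp add: kscale_def mult_map_scale_conv_mult)
  then show ?thesis
    by (simp add: Poly_Mapping.map.rep_eq when_def)
qed

lemma finite_tdeg_eq: "finite {\<alpha> :: 'n::finite expo. tdeg \<alpha> = d}"
proof -
  have "Poly_Mapping.lookup ` {\<alpha> :: 'n expo. tdeg \<alpha> = d} \<subseteq> PiE UNIV (\<lambda>_. {..d})"
  proof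
    fix f assume "f \<in> Poly_Mapping.lookup ` {\<alpha> :: 'n expo. tdeg \<alpha> = d}"
    then have "(\<Sum>i\<in>UNIV. f i) = d" by (auto simp: tdeg_def)
    then have "f i \<le> d" for i using member_le_sum[of i UNIV f] by simp
    then show "f \<in> PiE UNIV (\<lambda>_. {..d})" by (simp add: PiE_iff)
  qed
  moreover have "finite (PiE (UNIV :: 'n set) (\<lambda>_. {..d}))"
    by (rule finite_PiE) simp_all
  ultimately have "finite (Poly_Mapping.lookup ` {\<alpha> :: 'n expo. tdeg \<alpha> = d})"
    by (rule finite_subset)
  then show ?thesis
    by (rule finite_imageD) (simp add: inj_on_def lookup_inject)
qed

lemma mon_eq_iff [simp]: "(mon \<alpha> :: ('n, 'k::field) mpoly) = mon \<beta> \<longleftrightarrow> \<alpha> = \<beta>"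
  by (metis (no_types, lifting) mon_def keys_single one_neq_zero singleton_insert_inj_eq)

lemma mpoly_eq_sum: "(f :: ('n, 'k::field) mpoly) =
    (\<Sum>\<alpha>\<in>Poly_Mapping.keys f. kscale (Poly_Mapping.lookup f \<alpha>) (mon \<alpha>))"
  by (rule poly_mapping_eqI)
    (auto simp: lookup_sum lookup_kscale mon_def lookup_single when_def in_keys_iff
      if_distrib[where f = "\<lambda>x. _ * x"] cong: if_cong)

lemma dim_span_mon:
  fixes V :: "('n::finite, 'k::field) mpoly set"
  assumes A: "finite A" and sub: "mon ` A \<subseteq> V"
    and keys: "\<And>f. f \<in> V \<Longrightarrow> Poly_Mapping.keys f \<subseteq> A"
  shows "vector_space.dim kscale V = card A"
proof -
  interpret vs: vector_space "kscale :: 'k \<Rightarrow> ('n, 'k) mpoly \<Rightarrow> _"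
    by (rule vector_space_kscale)
  have "V \<subseteq> vs.span (mon ` A)"
  proof
    fix f assume "f \<in> V"
    then have "(\<Sum>\<alpha>\<in>Poly_Mapping.keys f. kscale (Poly_Mapping.lookup f \<alpha>) (mon \<alpha>)) \<in> vs.span (mon ` A)"
      using keys by (intro vs.span_sum vs.span_scale vs.span_base) auto
    then show "f \<in> vs.span (mon ` A)"
      using mpoly_eq_sum[of f] by simp
  qed
  moreover have "vs.independent (mon ` A)"
  proof (rule vs.independent_if_scalars_zero)
    show "finite (mon ` A :: ('n, 'k) mpoly set)" using A by simp
    fix u :: "('n, 'k) mpoly \<Rightarrow> 'k" and x :: "('n, 'k) mpoly"
    assume u: "(\<Sum>x\<in>mon ` A. kscale (u x) x) = 0" and "x \<in> mon ` A"
    then obtain \<beta> where b: "\<beta> \<in> A" "x = mon \<beta>" by auto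
    have "(\<Sum>\<alpha>\<in>A. kscale (u (mon \<alpha>)) (mon \<alpha>)) = 0"
      using u by (subst (asm) sum.reindex) (auto simp: inj_on_def)
    then have "Poly_Mapping.lookup (\<Sum>\<alpha>\<in>A. kscale (u (mon \<alpha>)) (mon \<alpha>)) \<beta> = 0" by simp
    then show "u x = 0"
      using A b by (simp add: lookup_sum lookup_kscale mon_def lookup_single when_def
          if_distrib[where f = "\<lambda>x. _ * x"] cong: if_cong)
  qed
  ultimately have "vs.dim V = card (mon ` A :: ('n, 'k) mpoly set)"
    using sub by (intro vs.dim_unique) auto
  also have "\<dots> = card A" by (intro card_image) (auto simp: inj_on_def)
  finally show ?thesis .
qed

lemma keys_ideal_gen_mon:
  fixes f :: "('n::finite, 'k::field) mpoly"
  assumes "f \<in> ideal_gen (mon ` A)" "\<alpha> \<in> Poly_Mapping.keys f"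
  shows "\<exists>\<beta>\<in>A. \<exists>\<gamma>. \<alpha> = \<gamma> + \<beta>"
proof -
  interpret m: module "(*) :: ('n, 'k) mpoly \<Rightarrow> _" by (rule module_mpoly)
  have "\<forall>\<alpha>\<in>Poly_Mapping.keys f. \<exists>\<beta>\<in>A. \<exists>\<gamma>. \<alpha> = \<gamma> + \<beta>"
    using assms(1) unfolding ideal_gen_def
  proof (induction rule: m.span_induct_alt)
    case base
    then show ?case by simp
  next
    case (step c x y)
    then show ?case
      using Poly_Mapping.keys_add[of "c * x" y] keys_mult[of c x]
      by (fastforce simp: mon_def)
  qed
  then show ?thesis using assms(2) by blast
qed

lemma mon_in_ideal_gen_iff:
  "(mon \<alpha> :: ('n::finite, 'k::field) mpoly) \<in> ideal_gen (mon ` A) \<longleftrightarrow> (\<exists>\<beta>\<in>A. \<exists>\<gamma>. \<alpha> = \<gamma> + \<beta>)"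
proof
  assume "(mon \<alpha> :: ('n, 'k) mpoly) \<in> ideal_gen (mon ` A)"
  then show "\<exists>\<beta>\<in>A. \<exists>\<gamma>. \<alpha> = \<gamma> + \<beta>"
    by (rule keys_ideal_gen_mon) (simp add: mon_def)
next
  interpret m: module "(*) :: ('n, 'k) mpoly \<Rightarrow> _" by (rule module_mpoly)
  assume "\<exists>\<beta>\<in>A. \<exists>\<gamma>. \<alpha> = \<gamma> + \<beta>"
  then obtain \<beta> \<gamma> where "\<beta> \<in> A" "\<alpha> = \<gamma> + \<beta>" by blast
  moreover from this have "(mon \<gamma> :: ('n, 'k) mpoly) * mon \<beta> \<in> m.span (mon ` A)"
    by (intro m.span_scale m.span_base) auto
  ultimately show "(mon \<alpha> :: ('n, 'k) mpoly) \<in> ideal_gen (mon ` A)"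
    by (simp add: ideal_gen_def mon_def mult_single)
qed

lemma hilbert_function_monomial:
  fixes A :: "'n::finite expo set"
  defines "I \<equiv> (ideal_gen (mon ` A) :: ('n, 'k::field) mpoly set)"
  shows "hilbert_function I d = mon_hilbert I d"
proof -
  let ?E = "{\<alpha> :: 'n expo. tdeg \<alpha> = d}" and ?EI = "{\<alpha>. tdeg \<alpha> = d \<and> (mon \<alpha> :: ('n, 'k) mpoly) \<in> I}"
  have "vector_space.dim kscale (graded_piece d :: ('n, 'k) mpoly set) = card ?E"
    by (intro dim_span_mon finite_tdeg_eq) (auto simp: graded_piece_def mon_def)
  moreover have "vector_space.dim kscale (I \<inter> graded_piece d) = card ?EI"
  proof (intro dim_span_mon)
    show "finite ?EI" by (rule finite_subset[OF _ finite_tdeg_eq[of d]]) auto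
    show "mon ` ?EI \<subseteq> I \<inter> graded_piece d" by (auto simp: graded_piece_def mon_def)
    show "Poly_Mapping.keys f \<subseteq> ?EI" if "f \<in> I \<inter> graded_piece d" for f
      using that keys_ideal_gen_mon[of f A] by (auto simp: I_def mon_in_ideal_gen_iff graded_piece_def)
  qed
  moreover have "{\<alpha>. tdeg \<alpha> = d \<and> (mon \<alpha> :: ('n, 'k) mpoly) \<notin> I} = ?E - ?EI" by auto
  ultimately show ?thesis
    unfolding hilbert_function_def mon_hilbert_def
    by (simp add: card_Diff_subset finite_tdeg_eq finite_subset[OF _ finite_tdeg_eq[of d]] Collect_mono)
qed

lemma min_gens_eq:
  fixes A :: "'n::finite expo set"
  defines "I \<equiv> (ideal_gen (mon ` A) :: ('n, 'k::field) mpoly set)"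
  shows "min_gens I = {\<alpha>. mon \<alpha> \<in> I \<and> (\<forall>\<beta> \<gamma>. mon \<beta> \<in> I \<and> \<alpha> = \<gamma> + \<beta> \<longrightarrow> \<gamma> = 0)}"
proof -
  interpret m: module "(*) :: ('n, 'k) mpoly \<Rightarrow> _" by (rule module_mpoly)
  define M where "M = {\<alpha>. mon \<alpha> \<in> I \<and> (\<forall>\<beta> \<gamma>. mon \<beta> \<in> I \<and> \<alpha> = \<gamma> + \<beta> \<longrightarrow> \<gamma> = 0)}"
  have sub: "M \<subseteq> G" if G: "ideal_gen (mon ` G) = I" for G
  proof
    fix \<alpha> assume a: "\<alpha> \<in> M"
    then have "(mon \<alpha> :: ('n, 'k) mpoly) \<in> ideal_gen (mon ` G)" by (simp add: M_def G)
    then obtain \<beta> \<gamma> where b: "\<beta> \<in> G" "\<alpha> = \<gamma> + \<beta>" unfolding mon_in_ideal_gen_iff by blast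
    then have "mon \<beta> \<in> I" by (auto simp: G[symmetric] ideal_gen_def intro: m.span_base)
    then have "\<gamma> = 0" using a b by (simp add: M_def)
    then show "\<alpha> \<in> G" using b by simp
  qed
  have ex: "\<exists>\<beta>\<in>M. \<exists>\<gamma>. \<alpha> = \<gamma> + \<beta>" if "mon \<alpha> \<in> I" for \<alpha>
    using that
  proof (induction "tdeg \<alpha>" arbitrary: \<alpha> rule: less_induct)
    case less
    show ?case
    proof (cases "\<alpha> \<in> M")
      case True
      then show ?thesis by (metis add_0)
    next
      case False
      then obtain \<beta> \<gamma> where b: "mon \<beta> \<in> I" "\<alpha> = \<gamma> + \<beta>" "\<gamma> \<noteq> 0"
        using less.prems by (auto simp: M_def)
      then obtain i where "Poly_Mapping.lookup \<gamma> i \<noteq> 0"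
        by (metis lookup_zero poly_mapping_eqI)
      then have "tdeg \<gamma> \<noteq> 0" unfolding tdeg_def by (subst sum_eq_0_iff) auto
      moreover have "tdeg \<alpha> = tdeg \<gamma> + tdeg \<beta>"
        using b by (simp add: tdeg_def lookup_add sum.distrib)
      ultimately have "tdeg \<beta> < tdeg \<alpha>" by simp
      then obtain \<delta> \<epsilon> where "\<delta> \<in> M" "\<beta> = \<epsilon> + \<delta>" using less.hyps b by blast
      then show ?thesis using b by (metis add.assoc)
    qed
  qed
  have gen: "ideal_gen (mon ` M) = I"
  proof
    show "ideal_gen (mon ` M) \<subseteq> I"
      unfolding ideal_gen_def
    proof (rule m.span_minimal)
      show "mon ` M \<subseteq> I" by (auto simp: M_def)
      show "m.subspace I" by (simp add: I_def ideal_gen_def)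
    qed
    have "(mon ` A :: ('n, 'k) mpoly set) \<subseteq> ideal_gen (mon ` M)"
    proof
      fix f :: "('n, 'k) mpoly" assume "f \<in> mon ` A"
      then have "f \<in> I" by (simp add: I_def ideal_gen_def m.span_base)
      moreover obtain \<alpha> where "f = mon \<alpha>" using \<open>f \<in> mon ` A\<close> by blast
      ultimately have "f = mon \<alpha>" "mon \<alpha> \<in> I" by simp_all
      then show "f \<in> ideal_gen (mon ` M)" using ex by (simp add: mon_in_ideal_gen_iff)
    qed
    then show "I \<subseteq> ideal_gen (mon ` M)"
      unfolding I_def ideal_gen_def by (intro m.span_minimal) auto
  qed
  have "min_gens I = M"
    unfolding min_gens_def
  proof (rule the_equality)
    show "ideal_gen (mon ` M) = I \<and> (\<forall>G'. G' \<subset> M \<longrightarrow> ideal_gen (mon ` G') \<noteq> I)"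
      using gen sub by blast
    show "G = M" if "ideal_gen (mon ` G) = I \<and> (\<forall>G'. G' \<subset> G \<longrightarrow> ideal_gen (mon ` G') \<noteq> I)" for G
      using that gen sub[of G] by blast
  qed
  then show ?thesis by (simp add: M_def)
qed

end

theory Submission
  imports Defs
begin

text \<open>
  A monomial ideal \<open>I\<close> generated in degrees at most \<open>D\<close> is determined by the finite set \<open>U\<close> of exponents
  of its monomials of degree between 1 and \<open>D\<close>, and the sets \<open>U\<close> that arise are those that are
  closed upwards, within these degrees, under the componentwise order.  The indicator functions of such sets, with
  the number of elements in each degree prescribed by \<open>h\<close>, are the 0-1 points that span the polytope.
  Every 0-1 point is a vertex of the convex hull of a set of 0-1 points
  (\<open>vertices_convex_hull_01\<close>), so the vertices correspond to the ideals whose Hilbert function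
  is \<open>h\<close> in the degrees up to \<open>D\<close> (\<open>bij_betw_vertex_ideal\<close>).

  For the probability, a set \<open>B\<close> of monomials generates \<open>I\<close> iff it contains the minimal generators
  and lies in \<open>I\<close> (\<open>ideal_gen_eq_iff\<close>).  So \<open>I\<close> is drawn iff \<open>\<beta>\<^sub>1(I)\<close> given monomials are chosen and
  the monomials outside \<open>I\<close>, of which there are \<open>h(1) + \<dots> + h(D)\<close> in the degrees concerned, are not.
  By independence this has probability \<open>p ^ \<beta>\<^sub>1(I) * (1 - p) ^ (h(1) + \<dots> + h(D))\<close>
  (\<open>pmf_random_monomial_ideal\<close>).  The second factor is the same for all ideals with these Hilbert
  function values, and summing over them gives the formula.
\<close>


section \<open>Exponent vectors\<close>

lemma cle_iff_add: "\<alpha> \<sqsubseteq>\<^sub>c \<gamma> \<longleftrightarrow> (\<exists>\<delta>. \<gamma> = \<delta> + \<alpha>)" for \<alpha> \<gamma> :: "'n::finite expo"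
proof
  assume "\<alpha> \<sqsubseteq>\<^sub>c \<gamma>"
  then have "\<gamma> = (\<gamma> - \<alpha>) + \<alpha>"
    by (intro poly_mapping_eqI) (simp add: cle_def lookup_add lookup_minus)
  then show "\<exists>\<delta>. \<gamma> = \<delta> + \<alpha>" ..
qed (auto simp: cle_def lookup_add)

lemma cle_refl: "\<alpha> \<sqsubseteq>\<^sub>c \<alpha>"
  by (simp add: cle_def)

lemma cle_trans: "\<alpha> \<sqsubseteq>\<^sub>c \<beta> \<Longrightarrow> \<beta> \<sqsubseteq>\<^sub>c \<gamma> \<Longrightarrow> \<alpha> \<sqsubseteq>\<^sub>c \<gamma>"
  unfolding cle_def using le_trans by blast

lemma tdeg_add: "tdeg (\<alpha> + \<beta>) = tdeg \<alpha> + tdeg \<beta>"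
  by (simp add: tdeg_def lookup_add sum.distrib)

lemma tdeg_eq_0_iff: "tdeg \<alpha> = 0 \<longleftrightarrow> \<alpha> = 0"
  by (auto simp: tdeg_def poly_mapping_eq_iff fun_eq_iff)

lemma tdeg_single: "tdeg (Poly_Mapping.single i k) = k"
  by (simp add: tdeg_def lookup_single when_def)

lemma finite_exps: "finite (exps D :: 'n::finite expo set)"
proof -
  have "(exps D :: 'n expo set) \<subseteq> (\<Union>d\<in>{1..D}. {\<alpha>. tdeg \<alpha> = d})"
    by (auto simp: exps_def)
  then show ?thesis
    by (rule finite_subset) (simp add: finite_tdeg_eq)
qed

text \<open>
  Once the variables are listed in some order, an exponent vector is a list of natural numbers with
  prescribed sum, and such lists are counted by stars and bars.
\<close>

lemma card_tdeg_eq: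
  "card {\<alpha> :: 'n::finite expo. tdeg \<alpha> = d} = (CARD('n) + d - 1) choose d"
proof -
  obtain xs :: "'n list" where xs: "set xs = UNIV" "distinct xs"
    using finite_distinct_list[OF finite] by blast
  then have len: "length xs = CARD('n)"
    by (metis distinct_card)
  let ?f = "\<lambda>\<alpha> :: 'n expo. map (Poly_Mapping.lookup \<alpha>) xs"
  have "bij_betw ?f {\<alpha>. tdeg \<alpha> = d} {l. length l = CARD('n) \<and> sum_list l = d}"
    unfolding bij_betw_def
  proof (intro conjI inj_onI equalityI subsetI)
    fix \<alpha> \<beta> assume "?f \<alpha> = ?f \<beta>"
    then show "\<alpha> = \<beta>"
      using xs by (auto intro: poly_mapping_eqI)
  next
    fix l assume "l \<in> ?f ` {\<alpha>. tdeg \<alpha> = d}"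
    then show "l \<in> {l. length l = CARD('n) \<and> sum_list l = d}"
      using xs len by (auto simp: tdeg_def sum_list_distinct_conv_sum_set)
  next
    fix l :: "nat list" assume l: "l \<in> {l. length l = CARD('n) \<and> sum_list l = d}"
    define \<alpha> where "\<alpha> = Abs_poly_mapping (\<lambda>i. the (map_of (zip xs l) i))"
    have "Poly_Mapping.lookup \<alpha> = (\<lambda>i. the (map_of (zip xs l) i))"
      by (simp add: \<alpha>_def)
    then have "?f \<alpha> = l"
      using l len xs by (intro nth_equalityI) (auto simp: map_of_zip_nth)
    moreover from this have "tdeg \<alpha> = d"
      using l xs sum_list_distinct_conv_sum_set[of xs "Poly_Mapping.lookup \<alpha>"]
      by (simp add: tdeg_def)
    ultimately show "l \<in> ?f ` {\<alpha>. tdeg \<alpha> = d}"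
      by blast
  qed
  then have "card {\<alpha> :: 'n expo. tdeg \<alpha> = d} = card {l. length l = CARD('n) \<and> sum_list l = d}"
    by (rule bij_betw_same_card)
  then show ?thesis
    by (simp add: card_length_sum_list add.commute)
qed

text \<open>
  The polytope compares only exponents of consecutive degrees.  That suffices: one climbs from
  \<open>\<alpha>\<close> to \<open>\<gamma>\<close> by raising one exponent at a time, and all the degrees reached lie between 1 and \<open>D\<close>.
\<close>

lemma upclosed_if_cover_closed:
  fixes U :: "'n::finite expo set"
  assumes cover: "\<And>\<alpha> \<gamma>. \<alpha> \<in> U \<Longrightarrow> \<gamma> \<in> exps D \<Longrightarrow> \<alpha> \<sqsubseteq>\<^sub>c \<gamma> \<Longrightarrow> tdeg \<alpha> + 1 = tdeg \<gamma> \<Longrightarrow> \<gamma> \<in> U"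
    and "\<alpha> \<in> U" "\<gamma> \<in> exps D" "\<alpha> \<sqsubseteq>\<^sub>c \<gamma>"
  shows "\<gamma> \<in> U"
proof -
  from \<open>\<alpha> \<sqsubseteq>\<^sub>c \<gamma>\<close> obtain \<delta> where "\<gamma> = \<delta> + \<alpha>"
    by (auto simp: cle_iff_add)
  with assms(2,3) show ?thesis
  proof (induction "tdeg \<delta>" arbitrary: \<delta> \<gamma>)
    case 0
    then show ?case by (simp add: tdeg_eq_0_iff)
  next
    case (Suc k)
    then have "\<delta> \<noteq> 0" by (metis Zero_not_Suc tdeg_eq_0_iff)
    then obtain i where "Poly_Mapping.lookup \<delta> i \<noteq> 0"
      by (metis lookup_zero poly_mapping_eqI)
    then have "Poly_Mapping.single i 1 \<sqsubseteq>\<^sub>c \<delta>"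
      by (auto simp: cle_def lookup_single when_def)
    then obtain \<epsilon> where e: "\<delta> = \<epsilon> + Poly_Mapping.single i 1"
      by (auto simp: cle_iff_add)
    have g: "\<gamma> = Poly_Mapping.single i 1 + (\<epsilon> + \<alpha>)"
      using Suc.prems e by (simp add: ac_simps)
    have "\<epsilon> + \<alpha> \<in> U"
    proof (cases "\<epsilon> + \<alpha> \<in> exps D")
      case True
      show ?thesis
        using Suc.hyps(2)
        by (intro Suc.hyps(1)[OF _ Suc.prems(1) True refl]) (simp add: e tdeg_add tdeg_single)
    next
      case False
      \<comment> \<open>The degree is then zero, so that nothing has been added to \<open>\<alpha>\<close> yet.\<close>
      then have "tdeg (\<epsilon> + \<alpha>) = 0"
        using Suc.prems(2) g by (auto simp: exps_def tdeg_add)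
      then have "\<epsilon> = 0"
        by (simp add: tdeg_add tdeg_eq_0_iff)
      then show ?thesis using Suc.prems by simp
    qed
    then show ?case
      using Suc.prems(2) by (rule cover) (auto simp: cle_iff_add g tdeg_add tdeg_single)
  qed
qed


section \<open>Monomial ideals and their monomials\<close>

lemma mon_in_ideal_gen:
  "(mon \<gamma> :: ('n::finite, 'k::field) mpoly) \<in> ideal_gen (mon ` A) \<longleftrightarrow> (\<exists>\<alpha>\<in>A. \<alpha> \<sqsubseteq>\<^sub>c \<gamma>)"
  by (simp add: mon_in_ideal_gen_iff cle_iff_add)

lemma mon_in_ideal_gen_base:
  "\<alpha> \<in> A \<Longrightarrow> (mon \<alpha> :: ('n::finite, 'k::field) mpoly) \<in> ideal_gen (mon ` A)"
  unfolding mon_in_ideal_gen using cle_refl by blast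

lemma ideal_gen_mon_subset:
  assumes "\<And>\<alpha>. \<alpha> \<in> A \<Longrightarrow> (mon \<alpha> :: ('n::finite, 'k::field) mpoly) \<in> ideal_gen (mon ` B)"
  shows "(ideal_gen (mon ` A) :: ('n, 'k) mpoly set) \<subseteq> ideal_gen (mon ` B)"
proof -
  interpret m: module "(*) :: ('n, 'k) mpoly \<Rightarrow> _" by (rule module_mpoly)
  show ?thesis
    using assms unfolding ideal_gen_def by (intro m.span_minimal) auto
qed

definition ideal_exps :: "nat \<Rightarrow> ('n::finite, 'k::field) mpoly set \<Rightarrow> 'n expo set" where
  "ideal_exps D I = {\<alpha> \<in> exps D. mon \<alpha> \<in> I}"

lemma ideal_gen_ideal_exps:
  fixes I :: "('n::finite, 'k::field) mpoly set"
  assumes "I \<in> monomial_ideals_upto D"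
  shows "ideal_gen (mon ` ideal_exps D I) = I"
proof -
  obtain A where A: "A \<subseteq> exps D" "I = ideal_gen (mon ` A)"
    using assms by (auto simp: monomial_ideals_upto_def)
  have "A \<subseteq> ideal_exps D I"
    using A by (auto simp: ideal_exps_def intro: mon_in_ideal_gen_base)
  then have "I \<subseteq> ideal_gen (mon ` ideal_exps D I)"
    unfolding A(2) by (intro ideal_gen_mon_subset) (auto intro: mon_in_ideal_gen_base)
  moreover have "ideal_gen (mon ` ideal_exps D I) \<subseteq> I"
    unfolding A(2) by (intro ideal_gen_mon_subset) (auto simp: ideal_exps_def)
  ultimately show ?thesis by blast
qed

lemma finite_monomial_ideals_upto:
  "finite (monomial_ideals_upto D :: ('n::finite, 'k::field) mpoly set set)"
proof -
  have "(monomial_ideals_upto D :: ('n, 'k) mpoly set set) = (\<lambda>A. ideal_gen (mon ` A)) ` Pow (exps D)"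
    by (auto simp: monomial_ideals_upto_def)
  then show ?thesis by (simp add: finite_exps)
qed

text \<open>
  Among the divisors of a monomial that lie in the ideal, one of least degree is minimal, so the
  minimal monomials generate.  They occur in every generating set of monomials, because a minimal
  monomial is a multiple of some generator and hence equal to it.
\<close>

lemma ideal_gen_min_gens:
  fixes A :: "'n::finite expo set"
  defines "I \<equiv> (ideal_gen (mon ` A) :: ('n, 'k::field) mpoly set)"
  shows "ideal_gen (mon ` min_gens I) = I" and "min_gens I \<subseteq> A"
proof -
  have M: "min_gens I = {\<alpha>. mon \<alpha> \<in> I \<and> (\<forall>\<beta> \<gamma>. mon \<beta> \<in> I \<and> \<alpha> = \<gamma> + \<beta> \<longrightarrow> \<gamma> = 0)}"
    unfolding I_def by (rule min_gens_eq)
  show "min_gens I \<subseteq> A"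
  proof
    fix \<alpha> assume a: "\<alpha> \<in> min_gens I"
    then have "mon \<alpha> \<in> I"
      by (simp add: M)
    then obtain \<beta> \<gamma> where b: "\<beta> \<in> A" "\<alpha> = \<gamma> + \<beta>"
      by (auto simp: I_def mon_in_ideal_gen_iff)
    moreover from this have "mon \<beta> \<in> I"
      by (simp add: I_def mon_in_ideal_gen_base)
    ultimately have "\<gamma> = 0"
      using a by (simp add: M)
    then show "\<alpha> \<in> A"
      using b by simp
  qed
  then have "ideal_gen (mon ` min_gens I) \<subseteq> I"
    unfolding I_def by (intro ideal_gen_mon_subset) (auto intro: mon_in_ideal_gen_base)
  moreover have "\<exists>\<beta>\<in>min_gens I. \<beta> \<sqsubseteq>\<^sub>c \<alpha>" if "mon \<alpha> \<in> I" for \<alpha>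
  proof -
    let ?P = "\<lambda>\<beta>. mon \<beta> \<in> I \<and> \<beta> \<sqsubseteq>\<^sub>c \<alpha>"
    define \<beta> where "\<beta> = (ARG_MIN tdeg \<beta>. ?P \<beta>)"
    have P: "?P \<alpha>" using that cle_refl by blast
    have b: "?P \<beta>" and least: "?P \<gamma> \<Longrightarrow> tdeg \<beta> \<le> tdeg \<gamma>" for \<gamma>
      using arg_min_nat_lemma[of ?P \<alpha> tdeg, OF P] unfolding \<beta>_def by blast+
    have "\<delta> = 0" if "mon \<gamma> \<in> I" "\<beta> = \<delta> + \<gamma>" for \<gamma> \<delta>
    proof -
      have "\<gamma> \<sqsubseteq>\<^sub>c \<alpha>" using b that cle_trans cle_iff_add by blast
      then show ?thesis using least[of \<gamma>] that by (simp add: tdeg_add tdeg_eq_0_iff)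
    qed
    then show ?thesis using b by (auto simp: M)
  qed
  then have "mon \<alpha> \<in> (ideal_gen (mon ` min_gens I) :: ('n, 'k) mpoly set)" if "\<alpha> \<in> A" for \<alpha>
    unfolding mon_in_ideal_gen[of \<alpha>] using that by (simp add: I_def mon_in_ideal_gen_base)
  then have "I \<subseteq> ideal_gen (mon ` min_gens I)"
    unfolding I_def by (rule ideal_gen_mon_subset)
  ultimately show "ideal_gen (mon ` min_gens I) = I" by blast
qed

text \<open>
  The minimal generators and the full set of monomials up to degree \<open>D\<close> both generate \<open>I\<close>; so does,
  by monotonicity, every set in between.
\<close>

lemma ideal_gen_eq_iff:
  fixes I :: "('n::finite, 'k::field) mpoly set"
  assumes I: "I \<in> monomial_ideals_upto D" and B: "B \<subseteq> exps D"
  shows "ideal_gen (mon ` B) = I \<longleftrightarrow> min_gens I \<subseteq> B \<and> B \<subseteq> ideal_exps D I"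
proof
  assume "ideal_gen (mon ` B) = I"
  then show "min_gens I \<subseteq> B \<and> B \<subseteq> ideal_exps D I"
    using ideal_gen_min_gens(2)[of B, where 'k = 'k] B
    by (auto simp: ideal_exps_def intro: mon_in_ideal_gen_base)
next
  assume sub: "min_gens I \<subseteq> B \<and> B \<subseteq> ideal_exps D I"
  obtain A where A: "I = ideal_gen (mon ` A)"
    using I by (auto simp: monomial_ideals_upto_def)
  have "ideal_gen (mon ` min_gens I) \<subseteq> (ideal_gen (mon ` B) :: ('n, 'k) mpoly set)"
    using sub by (intro ideal_gen_mon_subset) (auto intro: mon_in_ideal_gen_base)
  moreover have "(ideal_gen (mon ` B) :: ('n, 'k) mpoly set) \<subseteq> I"
    using sub unfolding A by (intro ideal_gen_mon_subset) (auto simp: ideal_exps_def)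
  ultimately show "ideal_gen (mon ` B) = I"
    using ideal_gen_min_gens(1)[of A, where 'k = 'k] A by simp
qed

lemma mon_hilbert_ideal_exps:
  fixes I :: "('n::finite, 'k::field) mpoly set"
  assumes "L \<in> {1..D}"
  shows "mon_hilbert I L + card {\<alpha> \<in> ideal_exps D I. tdeg \<alpha> = L} = (CARD('n) + L - 1) choose L"
proof -
  let ?E = "{\<alpha>. tdeg \<alpha> = L \<and> (mon \<alpha> :: ('n, 'k) mpoly) \<notin> I}" and ?F = "{\<alpha> \<in> ideal_exps D I. tdeg \<alpha> = L}"
  have part: "?E \<union> ?F = {\<alpha>. tdeg \<alpha> = L}" "?E \<inter> ?F = {}"
    using assms by (auto simp: ideal_exps_def exps_def)
  have "finite (?E \<union> ?F)"
    unfolding part(1) by (rule finite_tdeg_eq)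
  then have "card ?E + card ?F = card {\<alpha> :: 'n expo. tdeg \<alpha> = L}"
    using card_Un_disjoint[of ?E ?F] part by simp
  then show ?thesis
    by (simp only: mon_hilbert_def card_tdeg_eq)
qed

lemma card_standard_exps:
  fixes I :: "('n::finite, 'k::field) mpoly set"
  shows "card (exps D - ideal_exps D I) = (\<Sum>d=1..D. mon_hilbert I d)"
proof -
  let ?E = "\<lambda>d. {\<alpha>. tdeg \<alpha> = d \<and> (mon \<alpha> :: ('n, 'k) mpoly) \<notin> I}"
  have "exps D - ideal_exps D I = (\<Union>d\<in>{1..D}. ?E d)"
    by (auto simp: ideal_exps_def exps_def)
  moreover have "finite (?E d)" for d
    by (rule finite_subset[OF _ finite_tdeg_eq[of d]]) auto
  moreover have "disjoint_family_on ?E {1..D}"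
    by (auto simp: disjoint_family_on_def)
  ultimately show ?thesis
    by (simp add: card_UN_disjoint' mon_hilbert_def)
qed


section \<open>Vertices of the polytope\<close>

lemma lookup_scaleR:
  "Poly_Mapping.lookup (c *\<^sub>R x) \<alpha> = c *\<^sub>R Poly_Mapping.lookup x \<alpha>"
  for x :: "'a \<Rightarrow>\<^sub>0 'b::real_vector"
proof -
  have "finite {i. c *\<^sub>R Poly_Mapping.lookup x i \<noteq> 0}"
    by (rule finite_subset[OF _ finite_keys[of x]]) (auto simp: in_keys_iff)
  then show ?thesis
    by (simp add: scaleR_poly_mapping_def)
qed

text \<open>
  In each coordinate, a proper convex combination of numbers of the unit interval is 0 or 1 only
  if both of them are.  Hence no 0-1 point lies strictly between two points of the hull.
\<close>

lemma vertices_convex_hull_01: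
  fixes S :: "('a \<Rightarrow>\<^sub>0 real) set"
  assumes S: "\<And>x \<alpha>. x \<in> S \<Longrightarrow> Poly_Mapping.lookup x \<alpha> \<in> {0, 1}"
  shows "vertices (convex hull S) = S"
proof
  show "vertices (convex hull S) \<subseteq> S"
    by (auto simp: vertices_def intro: extreme_point_of_convex_hull)
  define C where "C = {x :: 'a \<Rightarrow>\<^sub>0 real. \<forall>\<alpha>. Poly_Mapping.lookup x \<alpha> \<in> {0..1}}"
  have "convex C"
  proof (rule convexI)
    fix x y :: "'a \<Rightarrow>\<^sub>0 real" and u v :: real
    assume *: "x \<in> C" "y \<in> C" "0 \<le> u" "0 \<le> v" "u + v = 1"
    show "u *\<^sub>R x + v *\<^sub>R y \<in> C"
      using * convexD[OF convex_real_interval(5)[of 0 1], of _ _ u v]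
      by (auto simp: C_def lookup_add lookup_scaleR simp del: atLeastAtMost_iff)
  qed
  moreover have "S \<subseteq> C"
    unfolding C_def
  proof (intro subsetI CollectI allI)
    fix x \<alpha> assume "x \<in> S"
    then show "Poly_Mapping.lookup x \<alpha> \<in> {0..1}"
      using S[of x \<alpha>] by auto
  qed
  ultimately have hull: "convex hull S \<subseteq> C"
    by (intro hull_minimal)
  show "S \<subseteq> vertices (convex hull S)"
  proof
    fix x assume x: "x \<in> S"
    have "x \<notin> open_segment a b" if ab: "a \<in> convex hull S" "b \<in> convex hull S" for a b
    proof
      assume "x \<in> open_segment a b"
      then obtain u where "a \<noteq> b" and u: "0 < u" "u < 1" "x = (1 - u) *\<^sub>R a + u *\<^sub>R b"
        by (auto simp: in_segment)
      have "Poly_Mapping.lookup a \<alpha> = Poly_Mapping.lookup b \<alpha>" for \<alpha>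
      proof -
        let ?a = "Poly_Mapping.lookup a \<alpha>" and ?b = "Poly_Mapping.lookup b \<alpha>"
        have r: "0 \<le> ?a" "?a \<le> 1" "0 \<le> ?b" "?b \<le> 1"
          using ab hull by (auto simp: C_def)
        have "Poly_Mapping.lookup x \<alpha> = (1 - u) * ?a + u * ?b"
          by (simp add: u lookup_add lookup_scaleR)
        then consider "(1 - u) * ?a + u * ?b = 0" | "(1 - u) * ?a + u * ?b = 1"
          using S[OF x, of \<alpha>] by auto
        then show ?thesis
        proof cases
          case 1
          then show ?thesis
            using r u by (simp add: add_nonneg_eq_0_iff)
        next
          case 2
          then have "(1 - u) * (1 - ?a) + u * (1 - ?b) = 0"
            by (simp add: algebra_simps)
          then show ?thesis
            using r u by (simp add: add_nonneg_eq_0_iff)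
        qed
      qed
      then show False
        using \<open>a \<noteq> b\<close> by (auto intro: poly_mapping_eqI)
    qed
    then show "x \<in> vertices (convex hull S)"
      using x by (auto simp: vertices_def extreme_point_of_def intro: hull_inc)
  qed
qed

lemma Q_points_01:
  assumes "x \<in> Q_points D h"
  shows "Poly_Mapping.lookup x \<alpha> \<in> {0, 1}"
  using assms by (cases "\<alpha> \<in> exps D") (auto simp: Q_points_def in_keys_iff)

lemma vertices_Q: "vertices (Q D h) = Q_points D h"
  unfolding Q_def using Q_points_01 by (rule vertices_convex_hull_01)

text \<open>
  The monotonicity constraints make the support of a point the full set of monomials of its ideal
  in the degrees up to \<open>D\<close>; so a point can be read off from its ideal.
\<close>

lemma ideal_exps_vertex_ideal:
  assumes v: "v \<in> Q_points D h"
  shows "ideal_exps D (vertex_ideal v :: ('n::finite, 'k::field) mpoly set)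
    = {\<alpha>. Poly_Mapping.lookup v \<alpha> = 1}" (is "_ = ?U")
proof -
  have U: "?U \<subseteq> exps D"
    using v by (fastforce simp: Q_points_def in_keys_iff)
  have "\<gamma> \<in> ?U" if "\<alpha> \<in> ?U" "\<gamma> \<in> exps D" "\<alpha> \<sqsubseteq>\<^sub>c \<gamma>" for \<alpha> \<gamma>
    using _ that
  proof (rule upclosed_if_cover_closed)
    fix \<alpha> \<gamma> :: "'n expo"
    assume *: "\<alpha> \<in> ?U" "\<gamma> \<in> exps D" "\<alpha> \<sqsubseteq>\<^sub>c \<gamma>" "tdeg \<alpha> + 1 = tdeg \<gamma>"
    then have "Poly_Mapping.lookup v \<alpha> \<le> Poly_Mapping.lookup v \<gamma>"
      using v U unfolding Q_points_def by blast
    then show "\<gamma> \<in> ?U"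
      using * Q_points_01[OF v, of \<gamma>] by auto
  qed
  then show ?thesis
    using U by (auto simp: ideal_exps_def vertex_ideal_def mon_in_ideal_gen intro: cle_refl)
qed

lemma sum_01_lookup:
  fixes v :: "'n::finite expo \<Rightarrow>\<^sub>0 real"
  assumes "\<And>\<alpha>. Poly_Mapping.lookup v \<alpha> \<in> {0, 1}"
  shows "(\<Sum>\<alpha> | tdeg \<alpha> = L. Poly_Mapping.lookup v \<alpha>)
    = real (card {\<alpha> \<in> {\<alpha>. Poly_Mapping.lookup v \<alpha> = 1}. tdeg \<alpha> = L})"
proof -
  have "(\<Sum>\<alpha> | tdeg \<alpha> = L. Poly_Mapping.lookup v \<alpha>)
      = (\<Sum>\<alpha> | tdeg \<alpha> = L. if Poly_Mapping.lookup v \<alpha> = 1 then 1 else 0)"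
    using assms by (intro sum.cong) force+
  also have "\<dots> = real (card ({\<alpha>. tdeg \<alpha> = L} \<inter> {\<alpha>. Poly_Mapping.lookup v \<alpha> = 1}))"
    by (simp add: sum.If_cases finite_tdeg_eq)
  also have "{\<alpha>. tdeg \<alpha> = L} \<inter> {\<alpha>. Poly_Mapping.lookup v \<alpha> = 1}
      = {\<alpha> \<in> {\<alpha>. Poly_Mapping.lookup v \<alpha> = 1}. tdeg \<alpha> = L}"
    by auto
  finally show ?thesis .
qed

text \<open>
  The count of monomials of degree \<open>L\<close> in the ideal is the left-hand side of the \<open>L\<close>-th equation of
  the polytope, so the equations say that the Hilbert function takes the values of \<open>h\<close>.  The preimage of
  an ideal is the indicator function of its monomials, not that of a generating set, since only
  the former is monotone.
\<close>

lemma bij_betw_vertex_ideal: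
  fixes h :: "nat \<Rightarrow> nat"
  shows "bij_betw vertex_ideal (vertices (Q D h :: ('n::finite expo \<Rightarrow>\<^sub>0 real) set))
    {I :: ('n, 'k::field) mpoly set. I \<in> monomial_ideals_upto D \<and> (\<forall>d\<in>{1..D}. mon_hilbert I d = h d)}"
    (is "bij_betw _ _ ?H")
  unfolding vertices_Q bij_betw_def
proof (intro conjI inj_onI equalityI subsetI)
  fix v w :: "'n expo \<Rightarrow>\<^sub>0 real"
  assume v: "v \<in> Q_points D h" and w: "w \<in> Q_points D h"
    and "(vertex_ideal v :: ('n, 'k) mpoly set) = vertex_ideal w"
  then have "{\<alpha>. Poly_Mapping.lookup v \<alpha> = 1} = {\<alpha>. Poly_Mapping.lookup w \<alpha> = 1}"
    using ideal_exps_vertex_ideal[OF v, where 'k = 'k] ideal_exps_vertex_ideal[OF w, where 'k = 'k]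
    by simp
  then show "v = w"
    using Q_points_01[OF v] Q_points_01[OF w]
    by (intro poly_mapping_eqI) (metis (mono_tags, lifting) insertE mem_Collect_eq singletonD)
next
  fix I :: "('n, 'k) mpoly set"
  assume "I \<in> vertex_ideal ` Q_points D h"
  then obtain v where v: "v \<in> Q_points D h" "I = vertex_ideal v" by blast
  have "{\<alpha>. Poly_Mapping.lookup v \<alpha> = 1} \<subseteq> exps D"
    unfolding ideal_exps_vertex_ideal[OF v(1), where 'k = 'k, symmetric]
    by (auto simp: ideal_exps_def)
  then have "I \<in> monomial_ideals_upto D"
    unfolding monomial_ideals_upto_def v(2) vertex_ideal_def by blast
  moreover have "mon_hilbert I L = h L" if L: "L \<in> {1..D}" for L
  proof -
    have "(\<Sum>\<alpha> | tdeg \<alpha> = L. Poly_Mapping.lookup v \<alpha>)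
        = real ((CARD('n) + L - 1) choose L) - real (h L)"
      using v(1) L by (simp add: Q_points_def)
    moreover have "(\<Sum>\<alpha> | tdeg \<alpha> = L. Poly_Mapping.lookup v \<alpha>)
        = real (card {\<alpha> \<in> ideal_exps D I. tdeg \<alpha> = L})"
      using sum_01_lookup[of v L, OF Q_points_01[OF v(1)]]
      unfolding v(2) ideal_exps_vertex_ideal[OF v(1)] .
    ultimately show ?thesis
      using mon_hilbert_ideal_exps[OF L, of I] by linarith
  qed
  ultimately show "I \<in> ?H" by blast
next
  fix I :: "('n, 'k) mpoly set"
  assume I: "I \<in> ?H"
  define v :: "'n expo \<Rightarrow>\<^sub>0 real"
    where "v = Abs_poly_mapping (\<lambda>\<alpha>. if \<alpha> \<in> ideal_exps D I then 1 else 0)"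
  have "finite (ideal_exps D I)"
    by (simp add: ideal_exps_def finite_exps)
  then have lv: "Poly_Mapping.lookup v = (\<lambda>\<alpha>. if \<alpha> \<in> ideal_exps D I then 1 else 0)"
    unfolding v_def by (subst lookup_Abs_poly_mapping) auto
  then have supp: "{\<alpha>. Poly_Mapping.lookup v \<alpha> = 1} = ideal_exps D I" by auto
  obtain A where A: "I = ideal_gen (mon ` A)"
    using I by (auto simp: monomial_ideals_upto_def)
  have "Poly_Mapping.keys v \<subseteq> exps D"
    by (auto simp: in_keys_iff lv ideal_exps_def split: if_splits)
  moreover have "Poly_Mapping.lookup v \<alpha> \<in> {0, 1}" for \<alpha>
    by (simp add: lv)
  moreover have "(\<Sum>\<alpha> | tdeg \<alpha> = L. Poly_Mapping.lookup v \<alpha>)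
      = real ((CARD('n) + L - 1) choose L) - real (h L)" if L: "L \<in> {1..D}" for L
    using sum_01_lookup[of v L] mon_hilbert_ideal_exps[OF L, of I] I L
    unfolding supp by (simp add: lv)
  moreover have "Poly_Mapping.lookup v \<alpha> \<le> Poly_Mapping.lookup v \<gamma>"
    if "\<gamma> \<in> exps D" "\<alpha> \<sqsubseteq>\<^sub>c \<gamma>" for \<alpha> \<gamma>
    using that by (auto simp: lv ideal_exps_def A mon_in_ideal_gen intro: cle_trans)
  ultimately have "v \<in> Q_points D h"
    unfolding Q_points_def by blast
  moreover have "vertex_ideal v = I"
    using I by (simp add: vertex_ideal_def supp ideal_gen_ideal_exps)
  ultimately show "I \<in> vertex_ideal ` Q_points D h" by blast
qed


section \<open>The distribution of the random ideal\<close>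

lemma random_monomial_ideal_conv_Pi_pmf:
  "random_monomial_ideal D p = map_pmf (\<lambda>b. ideal_gen (mon ` {\<alpha>. b \<alpha>}))
     (Pi_pmf (exps D) False (\<lambda>_. bernoulli_pmf p))"
  by (simp add: random_monomial_ideal_def random_monomials_def pmf.map_comp o_def)

lemma support_Pi_bernoulli:
  assumes "b \<in> set_pmf (Pi_pmf (exps D) False (\<lambda>_. bernoulli_pmf p))"
  shows "{\<alpha>. b \<alpha>} \<subseteq> exps D"
proof
  fix \<alpha> assume "\<alpha> \<in> {\<alpha>. b \<alpha>}"
  then show "\<alpha> \<in> exps D"
    using subsetD[OF set_Pi_pmf_subset[OF finite_exps] assms] by auto
qed

lemma set_random_monomial_ideal:
  "set_pmf (random_monomial_ideal D p :: ('n::finite, 'k::field) mpoly set pmf) \<subseteq> monomial_ideals_upto D"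
  unfolding random_monomial_ideal_conv_Pi_pmf monomial_ideals_upto_def
  unfolding set_map_pmf
proof (intro image_subsetI CollectI)
  fix b :: "'n expo \<Rightarrow> bool"
  assume "b \<in> set_pmf (Pi_pmf (exps D) False (\<lambda>_. bernoulli_pmf p))"
  then have "{\<alpha>. b \<alpha>} \<subseteq> exps D"
    by (rule support_Pi_bernoulli)
  then show "\<exists>A\<subseteq>exps D. (ideal_gen (mon ` {\<alpha>. b \<alpha>}) :: ('n, 'k) mpoly set) = ideal_gen (mon ` A)"
    by blast
qed

text \<open>
  Drawing a generating set of \<open>I\<close> forces each minimal generator to be drawn and each monomial
  outside \<open>I\<close> of degree between 1 and \<open>D\<close> to be left out; the remaining monomials of \<open>I\<close> are free
  and contribute a factor 1.
\<close>

lemma pmf_random_monomial_ideal: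
  fixes I :: "('n::finite, 'k::field) mpoly set"
  assumes I: "I \<in> monomial_ideals_upto D" and p: "0 \<le> p" "p \<le> 1"
  shows "pmf (random_monomial_ideal D p) I = p ^ betti1 I * (1 - p) ^ (\<Sum>d=1..D. mon_hilbert I d)"
proof -
  let ?M = "Pi_pmf (exps D) False (\<lambda>_. bernoulli_pmf p) :: ('n expo \<Rightarrow> bool) pmf"
  let ?G = "min_gens I" and ?N = "exps D - ideal_exps D I"
  define X where "X \<alpha> = (if \<alpha> \<in> ?G then {True} else if \<alpha> \<in> ?N then {False} else UNIV)" for \<alpha>
  have "ideal_gen (mon ` ideal_exps D I) = I"
    by (rule ideal_gen_ideal_exps[OF I])
  then have G: "?G \<subseteq> ideal_exps D I"
    using ideal_gen_eq_iff[OF I, of "ideal_exps D I"] by (auto simp: ideal_exps_def)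
  then have G': "?G \<subseteq> exps D" by (auto simp: ideal_exps_def)
  have "pmf (random_monomial_ideal D p) I = measure ?M {b. ideal_gen (mon ` {\<alpha>. b \<alpha>}) = I}"
    by (simp add: random_monomial_ideal_conv_Pi_pmf pmf_map vimage_def)
  also have "\<dots> = measure ?M (Pi (exps D) X)"
  proof (rule measure_prob_cong_0)
    have iff: "ideal_gen (mon ` {\<alpha>. b \<alpha>}) = I \<longleftrightarrow> b \<in> Pi (exps D) X" if "b \<in> set_pmf ?M" for b
    proof -
      have "{\<alpha>. b \<alpha>} \<subseteq> exps D" using that by (rule support_Pi_bernoulli)
      then show ?thesis
        unfolding ideal_gen_eq_iff[OF I \<open>{\<alpha>. b \<alpha>} \<subseteq> exps D\<close>]
        using G G' by (auto simp: X_def Pi_def split: if_splits)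
    qed
    show "pmf ?M b = 0" if "b \<in> {b. ideal_gen (mon ` {\<alpha>. b \<alpha>}) = I} - Pi (exps D) X" for b
      using iff that by (auto simp: set_pmf_iff)
    show "pmf ?M b = 0" if "b \<in> Pi (exps D) X - {b. ideal_gen (mon ` {\<alpha>. b \<alpha>}) = I}" for b
      using iff that by (auto simp: set_pmf_iff)
  qed
  also have "\<dots> = (\<Prod>\<alpha>\<in>exps D. measure (bernoulli_pmf p) (X \<alpha>))"
    by (simp add: measure_Pi_pmf_Pi finite_exps)
  also have "\<dots> = (\<Prod>\<alpha>\<in>exps D. (if \<alpha> \<in> ?G then p else 1) * (if \<alpha> \<in> ?N then 1 - p else 1))"
    using G p by (intro prod.cong) (auto simp: X_def measure_pmf_single)
  also have "\<dots> = p ^ card ?G * (1 - p) ^ card ?N"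
    using prod.inter_restrict[OF finite_exps, of "\<lambda>_. p" D ?G]
      prod.inter_restrict[OF finite_exps, of "\<lambda>_. 1 - p" D ?N] G'
    by (simp add: prod.distrib Int_absorb1)
  finally show ?thesis
    by (simp add: betti1_def card_standard_exps)
qed

theorem theorem2p4:
  fixes J :: "('n::finite, 'k::field) mpoly set"
    and h :: "nat \<Rightarrow> nat" and D :: nat and p :: real
  assumes "homogeneous_ideal J" and "h = hilbert_function J"
    and "0 \<le> p" and "p \<le> 1"
  shows
    "bij_betw vertex_ideal
       (vertices (Q D h :: ('n expo \<Rightarrow>\<^sub>0 real) set))
       {I :: ('n, 'k) mpoly set. I \<in> monomial_ideals_upto D \<and> (\<forall>d\<in>{1..D}. mon_hilbert I d = h d)}
     \<and>
     measure_pmf.prob (random_monomial_ideal D p)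
         {I :: ('n, 'k) mpoly set. \<forall>d\<in>{1..D}. mon_hilbert I d = h d}
       = (1 - p) ^ (\<Sum>d=1..D. h d) *
         (\<Sum>v\<in>vertices (Q D h :: ('n expo \<Rightarrow>\<^sub>0 real) set).
            p ^ betti1 (vertex_ideal v :: ('n, 'k) mpoly set))
     \<and>
     (bij_betw vertex_ideal
        (vertices (Q D h :: ('n expo \<Rightarrow>\<^sub>0 real) set))
        {I :: ('n, 'k) mpoly set. I \<in> monomial_ideals_upto D \<and> mon_hilbert I = h}
      \<longrightarrow>
      measure_pmf.prob (random_monomial_ideal D p) {I :: ('n, 'k) mpoly set. mon_hilbert I = h}
       = (1 - p) ^ (\<Sum>d=1..D. h d) *
         (\<Sum>v\<in>vertices (Q D h :: ('n expo \<Rightarrow>\<^sub>0 real) set).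
            p ^ betti1 (vertex_ideal v :: ('n, 'k) mpoly set)))"
proof -
  let ?R = "random_monomial_ideal D p :: ('n, 'k) mpoly set pmf"
  let ?V = "vertices (Q D h :: ('n expo \<Rightarrow>\<^sub>0 real) set)"
  let ?H = "{I :: ('n, 'k) mpoly set. I \<in> monomial_ideals_upto D \<and> (\<forall>d\<in>{1..D}. mon_hilbert I d = h d)}"
  let ?sum = "(1 - p) ^ (\<Sum>d=1..D. h d) * (\<Sum>v\<in>?V. p ^ betti1 (vertex_ideal v :: ('n, 'k) mpoly set))"
  have bij: "bij_betw vertex_ideal ?V ?H"
    by (rule bij_betw_vertex_ideal)
  have restrict: "measure ?R S = measure ?R (S \<inter> monomial_ideals_upto D)" for S
    using set_random_monomial_ideal[of D p, where 'n = 'n and 'k = 'k]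
    by (intro measure_prob_cong_0) (auto simp: subset_iff set_pmf_iff)
  have "measure ?R ?H = (\<Sum>I\<in>?H. pmf ?R I)"
    by (rule measure_measure_pmf_finite) (simp add: finite_monomial_ideals_upto)
  also have "\<dots> = (\<Sum>I\<in>?H. p ^ betti1 I * (1 - p) ^ (\<Sum>d=1..D. h d))"
    using assms(3,4) by (intro sum.cong) (simp_all add: pmf_random_monomial_ideal)
  also have "\<dots> = (\<Sum>v\<in>?V. p ^ betti1 (vertex_ideal v :: ('n, 'k) mpoly set) * (1 - p) ^ (\<Sum>d=1..D. h d))"
    by (rule sum.reindex_bij_betw[OF bij, symmetric])
  also have "\<dots> = ?sum"
    by (simp add: sum_distrib_left mult.commute)
  finally have H: "measure ?R ?H = ?sum" .
  have "measure ?R {I. \<forall>d\<in>{1..D}. mon_hilbert I d = h d} = ?sum"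
    unfolding H[symmetric] by (subst restrict) (simp add: Int_def conj_commute)
  moreover have "measure ?R {I. mon_hilbert I = h} = ?sum"
    if "bij_betw vertex_ideal ?V {I :: ('n, 'k) mpoly set. I \<in> monomial_ideals_upto D \<and> mon_hilbert I = h}"
  proof -
    \<comment> \<open>Both sets of ideals are the image of the vertices, so they agree.\<close>
    have "{I. I \<in> monomial_ideals_upto D \<and> mon_hilbert I = h} = ?H"
      using that bij by (simp add: bij_betw_def)
    then show ?thesis
      unfolding H[symmetric] by (subst restrict) (simp add: Int_def conj_commute)
  qed
  ultimately show ?thesis
    using bij by blast
qed

end
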